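(* Let $\phi(\zeta,t)=-q_t+d_t\zeta+\int_0^\infty(e^{-\zeta x}-1)\pi_t(\mathrm dx)$ for $\zeta\in\mathbb H$ and a.e. $t\ge0$, where $q_t\ge0$, $d_t\in\mathbb R$, $\pi_t$ are nonnegative Borel measures on $(0,\infty)$, $t\mapsto q_t$ and $t\mapsto d_t$ are in $L^1_{\rm loc}$, and $\min\{x,1\}\pi_t(\mathrm dx)$ is locally integrable in $t$. Let $(v_{s,t})$ be the absolutely continuous reverse evolution family (contained in $\mathcal{BF}$) with Herglotz vector field $\phi$, and let $(Z_t)$ be the associated branching process. Then $\mathbb P^{(s,x)}[T_0^s<\infty]=0$ for every $x>0$ and $s\ge0$.
   Context: $\mathbb H=\{\operatorname{Re}\zeta>0\}$, $\Delta=\{(s,t):0\le s\le t\}$; $L^1_{\rm loc}$: integrable on compact subintervals of $[0,\infty)$. A family of nonnegative measures $(\rho_t)$ is locally integrable in $t$ if $t\mapsto\rho_t(B)$ is measurable for all Borel $B$ and $t\mapsto\rho_t(\text{total})$ is in $L^1_{\rm loc}$. $\mathcal{BF}$: Bernstein functions not identically zero, extended to $\mathbb H$. The absolutely continuous reverse evolution family $(v_{s,t})$ with Herglotz vector field $\phi$ is defined by: $s\mapsto v_{s,t}(\zeta)$ is the unique solution of $\frac{\mathrm d}{\mathrm ds}v(s)=\phi(v(s),s)$ a.e. on $[0,t]$, $v(t)=\zeta$. The associated branching process $(Z_t)$ on $[0,\infty]$ is a Markov family with probabilities $\mathbb P^{(s,x)}$ whose transition kernels $k_{s,t}$ (with $k_{s,t}(0,\cdot)=\delta_0$,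 $k_{s,t}(\infty,\cdot)=\delta_\infty$) satisfy $\int_{[0,\infty)}e^{-\theta y}k_{s,t}(x,\mathrm dy)=e^{-xv_{s,t}(\theta)}$, realized with sample paths in $D[0,\infty)$ (càdlàg paths into $[0,\infty]$ absorbed at $0$ and at $\infty$ once they or their left limits reach these points). $T_0^s=\inf\{t\ge s:Z_t=0\}$. *)

theory Defs
  imports "HOL-Probability.Probability"
begin

section \<open>Absolute continuity of functions on a compact interval\<close>

definition abs_continuous_on :: "real \<Rightarrow> real \<Rightarrow> (real \<Rightarrow> 'a::real_normed_vector) \<Rightarrow> bool" where
  "abs_continuous_on lo hi f \<longleftrightarrow>
     (\<forall>\<epsilon>>0. \<exists>\<delta>>0. \<forall>(n::nat) (a::nat \<Rightarrow> real) (b::nat \<Rightarrow> real).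
        (\<forall>i<n. lo \<le> a i \<and> a i \<le> b i \<and> b i \<le> hi) \<and>
        (\<forall>i<n. \<forall>j<n. i \<noteq> j \<longrightarrow> b i \<le> a j \<or> b j \<le> a i) \<and>
        (\<Sum>i<n. b i - a i) < \<delta>
        \<longrightarrow> (\<Sum>i<n. norm (f (b i) - f (a i))) < \<epsilon>)"

section \<open>Right half plane and Herglotz vector field\<close>

definition right_half_plane :: "complex set" where
  "right_half_plane = {\<zeta>. Re \<zeta> > 0}"

text \<open>phi(zeta,t) = -q_t + d_t zeta + integral over (0,infinity) of (exp(-zeta x) - 1) pi_t(dx).\<close>
definition herglotz_phi ::
  "(real \<Rightarrow> real) \<Rightarrow> (real \<Rightarrow> real) \<Rightarrow> (real \<Rightarrow> real measure) \<Rightarrow> complex \<Rightarrow> real \<Rightarrow> complex" where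
  "herglotz_phi q d \<pi> \<zeta> t =
     - complex_of_real (q t) + complex_of_real (d t) * \<zeta>
     + set_lebesgue_integral (\<pi> t) {0<..} (\<lambda>x. exp (- \<zeta> * complex_of_real x) - 1)"

text \<open>Locally integrable family of nonnegative measures (indexed by t in [0,infinity)).\<close>
definition loc_integrable_family :: "(real \<Rightarrow> real measure) \<Rightarrow> bool" where
  "loc_integrable_family \<rho> \<longleftrightarrow>
     (\<forall>B \<in> sets borel. (\<lambda>t. emeasure (\<rho> t) B) \<in> borel_measurable (restrict_space lborel {0..})) \<and>
     (\<forall>T\<ge>0. (\<integral>\<^sup>+ t \<in> {0..T}. emeasure (\<rho> t) UNIV \<partial>lborel) < \<infinity>)"

text \<open>Absolutely continuous reverse evolution family with Herglotz vector field phi: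
  for t >= 0 and zeta in H, s |-> v s t zeta is an absolutely continuous H-valued solution on [0,t]
  of dv/ds = phi(v(s),s) a.e., with v(t) = zeta (this solution is unique).\<close>
definition reverse_evolution_family ::
  "(complex \<Rightarrow> real \<Rightarrow> complex) \<Rightarrow> (real \<Rightarrow> real \<Rightarrow> complex \<Rightarrow> complex) \<Rightarrow> bool" where
  "reverse_evolution_family \<phi> v \<longleftrightarrow>
     (\<forall>t\<ge>0. \<forall>\<zeta>\<in>right_half_plane.
        v t t \<zeta> = \<zeta> \<and>
        (\<forall>s\<in>{0..t}. v s t \<zeta> \<in> right_half_plane) \<and>
        abs_continuous_on 0 t (\<lambda>s. v s t \<zeta>) \<and>
        (AE s in lborel. s \<in> {0..t} \<longrightarrow>
           ((\<lambda>r. v r t \<zeta>) has_vector_derivative \<phi> (v s t \<zeta>) s) (at s within {0..t})))"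

section \<open>Paths in D[0,infinity) absorbed at 0 and infinity\<close>

definition cadlag_absorbed :: "(real \<Rightarrow> ennreal) \<Rightarrow> bool" where
  "cadlag_absorbed w \<longleftrightarrow>
     (\<forall>t\<ge>0. (w \<longlongrightarrow> w t) (at_right t)) \<and>
     (\<forall>t>0. \<exists>l. (w \<longlongrightarrow> l) (at_left t)) \<and>
     (\<forall>t\<ge>0. \<forall>a\<in>{0, \<infinity>}. (w t = a \<or> (t > 0 \<and> (w \<longlongrightarrow> a) (at_left t)))
            \<longrightarrow> (\<forall>u\<ge>t. w u = a))"

section \<open>Branching process associated with v\<close>

text \<open>Transition kernels k s t x on [0,infinity] with k(0) = delta_0, k(infinity) = delta_infinity and
  Laplace transform exp(-x v_{s,t}(theta)) for finite x > 0 and theta > 0.\<close>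
definition branching_kernels ::
  "(real \<Rightarrow> real \<Rightarrow> complex \<Rightarrow> complex) \<Rightarrow> (real \<Rightarrow> real \<Rightarrow> ennreal \<Rightarrow> ennreal measure) \<Rightarrow> bool" where
  "branching_kernels v k \<longleftrightarrow>
     (\<forall>s t. 0 \<le> s \<and> s \<le> t \<longrightarrow>
        (\<forall>x. prob_space (k s t x) \<and> sets (k s t x) = sets borel) \<and>
        (\<forall>B \<in> sets borel. (\<lambda>x. emeasure (k s t x) B) \<in> borel_measurable borel) \<and>
        k s t 0 = return borel 0 \<and>
        k s t \<infinity> = return borel \<infinity> \<and>
        (\<forall>x. 0 < x \<and> x < \<infinity> \<longrightarrow> (\<forall>\<theta>::real. \<theta> > 0 \<longrightarrow>
           complex_of_real (set_lebesgue_integral (k s t x) {y. y \<noteq> \<infinity>} (\<lambda>y. exp (- \<theta> * enn2real y)))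
           = exp (- complex_of_real (enn2real x) * v s t (complex_of_real \<theta>)))))"

text \<open>Markov family (Z, P) with transition kernels k and sample paths in D[0,infinity):
  P s x is the law of the process started at time s in state x; the Markov property is
  with respect to the natural filtration sigma(Z_u : s <= u <= r).\<close>
definition branching_process ::
  "(real \<Rightarrow> real \<Rightarrow> ennreal \<Rightarrow> ennreal measure) \<Rightarrow> (real \<Rightarrow> ennreal \<Rightarrow> 'w measure)
     \<Rightarrow> (real \<Rightarrow> 'w \<Rightarrow> ennreal) \<Rightarrow> bool" where
  "branching_process k P Z \<longleftrightarrow>
     (\<forall>s\<ge>0. \<forall>x.
        prob_space (P s x) \<and>
        (\<forall>t. Z t \<in> borel_measurable (P s x)) \<and>
        (\<forall>w\<in>space (P s x). cadlag_absorbed (\<lambda>t. Z t w)) \<and>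
        emeasure (P s x) {w \<in> space (P s x). Z s w = x} = 1 \<and>
        (\<forall>r t. s \<le> r \<and> r \<le> t \<longrightarrow> (\<forall>B \<in> sets borel.
           \<forall>A \<in> sigma_sets (space (P s x)) (\<Union>u\<in>{s..r}. {Z u -` C \<inter> space (P s x) | C. C \<in> sets borel}).
             measure (P s x) (A \<inter> {w \<in> space (P s x). Z t w \<in> B})
             = set_lebesgue_integral (P s x) A (\<lambda>w. measure (k r t (Z r w)) B))))"

text \<open>Hitting time of 0 after time s (infinity if 0 is never hit).\<close>
definition hit_zero :: "(real \<Rightarrow> 'w \<Rightarrow> ennreal) \<Rightarrow> real \<Rightarrow> 'w \<Rightarrow> ereal" where
  "hit_zero Z s w = Inf (ereal ` {t. s \<le> t \<and> Z t w = 0})"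

end

theory Submission
  imports Defs
begin

(* By the Laplace transform of the kernels, P^(s,x)[Z_t = 0] is the limit of exp (-x v_{s,t}(theta)) as
   theta -> infinity, which vanishes as soon as Re v_{s,t}(theta) grows linearly in theta.  On the right half
   plane the killing term -q and the jump integral of the Herglotz field have nonpositive real part, so along
   the backward equation ln Re v has derivative at most |d|, whence Re v_{s,t}(theta) >= theta * exp (- the
   integral of |d| over [s,t]).  As v is only absolutely continuous, this integration needs the fundamental
   theorem of calculus for absolutely continuous functions, obtained here from the Luzin N property.
   Finally 0 is absorbing, so the event T_0^s < infinity is the countable union of the null events
   Z_{s+n} = 0. *)

section \<open>Absolutely continuous functions\<close>

lemma abs_continuous_onD:
  fixes G :: "real \<Rightarrow> 'a::real_normed_vector"
  assumes "abs_continuous_on a b G" "e > 0"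
  shows "\<exists>\<delta>>0. \<forall>(n::nat) p q. (\<forall>i<n. a \<le> p i \<and> p i \<le> q i \<and> q i \<le> b) \<longrightarrow>
       (\<forall>i<n. \<forall>j<n. i \<noteq> j \<longrightarrow> q i \<le> p j \<or> q j \<le> p i) \<longrightarrow>
       (\<Sum>i<n. q i - p i) < \<delta> \<longrightarrow> (\<Sum>i<n. norm (G (q i) - G (p i))) < e"
  using assms unfolding abs_continuous_on_def by (simp add: imp_conjL)

lemma abs_continuous_on_finite_family:
  fixes G :: "real \<Rightarrow> 'a::real_normed_vector"
  assumes "abs_continuous_on a b G" "e > 0"
  shows "\<exists>\<delta>>0. \<forall>I p q. finite I \<longrightarrow> (\<forall>i\<in>I. a \<le> p i \<and> p i \<le> q i \<and> q i \<le> b) \<longrightarrow>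
       (\<forall>i\<in>I. \<forall>j\<in>I. i \<noteq> j \<longrightarrow> q i \<le> p j \<or> q j \<le> p i) \<longrightarrow>
       (\<Sum>i\<in>I. q i - p i) < \<delta> \<longrightarrow> (\<Sum>i\<in>I. norm (G (q i) - G (p i))) < e"
proof -
  obtain \<delta> where "\<delta> > 0" and \<delta>: "\<forall>(n::nat) p q. (\<forall>i<n. a \<le> p i \<and> p i \<le> q i \<and> q i \<le> b) \<longrightarrow>
       (\<forall>i<n. \<forall>j<n. i \<noteq> j \<longrightarrow> q i \<le> p j \<or> q j \<le> p i) \<longrightarrow>
       (\<Sum>i<n. q i - p i) < \<delta> \<longrightarrow> (\<Sum>i<n. norm (G (q i) - G (p i))) < e"
    using abs_continuous_onD[OF assms] by (elim exE conjE)
  show ?thesis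
  proof (intro exI[of _ \<delta>] conjI allI impI)
    fix I :: "'i set" and p q :: "'i \<Rightarrow> real"
    assume I: "finite I" and pq: "\<forall>i\<in>I. a \<le> p i \<and> p i \<le> q i \<and> q i \<le> b"
      and sep: "\<forall>i\<in>I. \<forall>j\<in>I. i \<noteq> j \<longrightarrow> q i \<le> p j \<or> q j \<le> p i"
      and len: "(\<Sum>i\<in>I. q i - p i) < \<delta>"
    define f where "f = from_nat_into I"
    have f: "bij_betw f {..<card I} I"
      unfolding f_def by (rule bij_betw_from_nat_into_finite[OF I])
    have fI: "f n \<in> I" if "n < card I" for n
      using bij_betwE[OF f] that by blast
    have f_inj: "f n \<noteq> f m" if "n < card I" "m < card I" "n \<noteq> m" for n m
      using bij_betw_imp_inj_on[OF f] that by (auto simp: inj_on_def)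
    have reindex: "(\<Sum>i\<in>I. g i) = (\<Sum>n<card I. g (f n))" for g :: "'i \<Rightarrow> real"
      using sum.reindex_bij_betw[OF f, of g] by simp
    have "\<forall>n<card I. a \<le> p (f n) \<and> p (f n) \<le> q (f n) \<and> q (f n) \<le> b"
      using pq fI by blast
    moreover have "\<forall>n<card I. \<forall>m<card I. n \<noteq> m \<longrightarrow> q (f n) \<le> p (f m) \<or> q (f m) \<le> p (f n)"
      using sep fI f_inj by blast
    moreover have "(\<Sum>n<card I. q (f n) - p (f n)) < \<delta>"
      using len by (simp add: reindex)
    ultimately have "(\<Sum>n<card I. norm (G (q (f n)) - G (p (f n)))) < e"
      by (rule \<delta>[rule_format (no_asm), of "card I" "\<lambda>n. p (f n)" "\<lambda>n. q (f n)"])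
    then show "(\<Sum>i\<in>I. norm (G (q i) - G (p i))) < e"
      by (simp add: reindex)
  qed (rule \<open>\<delta> > 0\<close>)
qed

lemma abs_continuous_on_imp_continuous_on:
  fixes G :: "real \<Rightarrow> 'a::real_normed_vector"
  assumes "abs_continuous_on a b G"
  shows "continuous_on {a..b} G"
  unfolding continuous_on_iff
proof (intro ballI allI impI)
  fix x e :: real assume x: "x \<in> {a..b}" and "0 < e"
  obtain \<delta> where "\<delta> > 0" and \<delta>: "\<forall>(n::nat) p q. (\<forall>i<n. a \<le> p i \<and> p i \<le> q i \<and> q i \<le> b) \<longrightarrow>
       (\<forall>i<n. \<forall>j<n. i \<noteq> j \<longrightarrow> q i \<le> p j \<or> q j \<le> p i) \<longrightarrow>
       (\<Sum>i<n. q i - p i) < \<delta> \<longrightarrow> (\<Sum>i<n. norm (G (q i) - G (p i))) < e"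
    using abs_continuous_onD[OF assms \<open>0 < e\<close>] by (elim exE conjE)
  have "dist (G y) (G x) < e" if y: "y \<in> {a..b}" "dist y x < \<delta>" for y
  proof -
    have "(\<Sum>i<Suc 0. norm (G (max x y) - G (min x y))) < e"
    proof (rule \<delta>[rule_format (no_asm), of "Suc 0" "\<lambda>_. min x y" "\<lambda>_. max x y"])
      show "(\<Sum>i<Suc 0. max x y - min x y) < \<delta>"
        using y(2) by (cases "x \<le> y") (auto simp: dist_real_def max_def min_def)
    qed (use x y(1) in auto)
    then show ?thesis
      by (cases "x \<le> y") (auto simp: dist_norm norm_minus_commute max_def min_def)
  qed
  then show "\<exists>d>0. \<forall>y\<in>{a..b}. dist y x < d \<longrightarrow> dist (G y) (G x) < e"
    using \<open>\<delta> > 0\<close> by blast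
qed

lemma abs_continuous_on_lipschitz_comp:
  fixes f :: "real \<Rightarrow> 'a::real_normed_vector" and g :: "real \<Rightarrow> 'b::real_normed_vector"
  assumes f: "abs_continuous_on a b f" and cd: "a \<le> c" "d \<le> b" and "L > 0"
    and lip: "\<And>x y. x \<in> {c..d} \<Longrightarrow> y \<in> {c..d} \<Longrightarrow> norm (g y - g x) \<le> L * norm (f y - f x)"
  shows "abs_continuous_on c d g"
  unfolding abs_continuous_on_def
proof (intro allI impI)
  fix e :: real assume "e > 0"
  with \<open>L > 0\<close> have "e / L > 0" by simp
  obtain \<delta> where "\<delta> > 0" and \<delta>: "\<forall>(n::nat) p q. (\<forall>i<n. a \<le> p i \<and> p i \<le> q i \<and> q i \<le> b) \<longrightarrow>
       (\<forall>i<n. \<forall>j<n. i \<noteq> j \<longrightarrow> q i \<le> p j \<or> q j \<le> p i) \<longrightarrow>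
       (\<Sum>i<n. q i - p i) < \<delta> \<longrightarrow> (\<Sum>i<n. norm (f (q i) - f (p i))) < e / L"
    using abs_continuous_onD[OF f \<open>e / L > 0\<close>] by (elim exE conjE)
  show "\<exists>\<delta>>0. \<forall>(n::nat) (p::nat \<Rightarrow> real) (q::nat \<Rightarrow> real).
      (\<forall>i<n. c \<le> p i \<and> p i \<le> q i \<and> q i \<le> d) \<and>
      (\<forall>i<n. \<forall>j<n. i \<noteq> j \<longrightarrow> q i \<le> p j \<or> q j \<le> p i) \<and> (\<Sum>i<n. q i - p i) < \<delta>
      \<longrightarrow> (\<Sum>i<n. norm (g (q i) - g (p i))) < e"
  proof (intro exI[of _ \<delta>] conjI allI impI)
    fix n :: nat and p q :: "nat \<Rightarrow> real"
    assume "(\<forall>i<n. c \<le> p i \<and> p i \<le> q i \<and> q i \<le> d) \<and>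
      (\<forall>i<n. \<forall>j<n. i \<noteq> j \<longrightarrow> q i \<le> p j \<or> q j \<le> p i) \<and> (\<Sum>i<n. q i - p i) < \<delta>"
    then have pq: "\<forall>i<n. c \<le> p i \<and> p i \<le> q i \<and> q i \<le> d"
      and sep: "\<forall>i<n. \<forall>j<n. i \<noteq> j \<longrightarrow> q i \<le> p j \<or> q j \<le> p i"
      and len: "(\<Sum>i<n. q i - p i) < \<delta>"
      by blast+
    have "\<forall>i<n. a \<le> p i \<and> p i \<le> q i \<and> q i \<le> b"
      using pq cd by force
    then have "(\<Sum>i<n. norm (f (q i) - f (p i))) < e / L"
      using sep len by (rule \<delta>[rule_format (no_asm)])
    then have "L * (\<Sum>i<n. norm (f (q i) - f (p i))) < e"
      using \<open>L > 0\<close> by (simp add: pos_less_divide_eq mult.commute)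
    moreover have "(\<Sum>i<n. norm (g (q i) - g (p i))) \<le> L * (\<Sum>i<n. norm (f (q i) - f (p i)))"
      unfolding sum_distrib_left by (rule sum_mono) (use pq lip in auto)
    ultimately show "(\<Sum>i<n. norm (g (q i) - g (p i))) < e"
      by linarith
  qed (rule \<open>\<delta> > 0\<close>)
qed

section \<open>The Luzin N property\<close>

lemma continuous_on_Icc_measure_image_le:
  fixes G :: "real \<Rightarrow> real"
  assumes "continuous_on {l..r} G" "l \<le> r"
  shows "\<exists>p q. l \<le> p \<and> p \<le> q \<and> q \<le> r \<and> measure lebesgue (G ` {l..r}) \<le> \<bar>G q - G p\<bar>"
proof -
  obtain \<alpha> where \<alpha>: "\<alpha> \<in> {l..r}" "\<forall>y\<in>{l..r}. G \<alpha> \<le> G y"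
    using continuous_attains_inf[OF compact_Icc _ assms(1)] assms(2) by auto
  obtain \<beta> where \<beta>: "\<beta> \<in> {l..r}" "\<forall>y\<in>{l..r}. G y \<le> G \<beta>"
    using continuous_attains_sup[OF compact_Icc _ assms(1)] assms(2) by auto
  have "G ` {l..r} \<in> sets lebesgue"
    using assms(1) by (intro fmeasurableD lmeasurable_compact compact_continuous_image) auto
  then have "measure lebesgue (G ` {l..r}) \<le> measure lebesgue {G \<alpha>..G \<beta>}"
    using \<alpha> \<beta> by (intro measure_mono_fmeasurable) auto
  also have "\<dots> = \<bar>G (max \<alpha> \<beta>) - G (min \<alpha> \<beta>)\<bar>"
    using \<alpha> \<beta> by (cases "\<alpha> \<le> \<beta>") (auto simp: measure_def max_def min_def)
  finally show ?thesis
    using \<alpha> \<beta> by (intro exI[of _ "min \<alpha> \<beta>"] exI[of _ "max \<alpha> \<beta>"]) auto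
qed

lemma open_connected_subset_Ioo:
  fixes C :: "real set"
  assumes "open C" "connected C" "C \<noteq> {}" "C \<subseteq> {a<..<b}"
  shows "C = {Inf C<..<Sup C}" and "a \<le> Inf C" and "Inf C < Sup C" and "Sup C \<le> b"
proof -
  have lb: "\<forall>x\<in>C. a < x" and ub: "\<forall>x\<in>C. x < b"
    using assms(4) by auto
  then have bdd: "bdd_below C" "bdd_above C"
    by (meson bdd_belowI bdd_aboveI less_imp_le)+
  have "Inf C \<notin> C" "Sup C \<notin> C"
    using Inf_notin_open[OF assms(1) lb] Sup_notin_open[OF assms(1) ub] .
  then have "C \<subseteq> {Inf C<..<Sup C}"
    using bdd cInf_lower[of _ C] cSup_upper[of _ C] by (force simp: order.strict_iff_order)
  moreover have "{Inf C<..<Sup C} \<subseteq> C"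
  proof
    fix z assume z: "z \<in> {Inf C<..<Sup C}"
    obtain x where "x \<in> C" "x < z"
      using z assms(3) bdd(1) by (auto simp: cInf_less_iff)
    moreover obtain y where "y \<in> C" "z < y"
      using z assms(3) bdd(2) by (auto simp: less_cSup_iff)
    ultimately show "z \<in> C"
      using assms(2) unfolding connected_iff_interval by (meson less_imp_le)
  qed
  ultimately show C: "C = {Inf C<..<Sup C}"
    by blast
  show "a \<le> Inf C"
    using assms(3) lb by (meson cInf_greatest less_imp_le)
  show "Sup C \<le> b"
    using assms(3) ub by (meson cSup_least less_imp_le)
  show "Inf C < Sup C"
    using assms(3) C by (metis greaterThanLessThan_empty_iff not_less)
qed

lemma disjoint_Ioo_separated:
  fixes a b c d :: real
  assumes "{a<..<b} \<inter> {c<..<d} = {}" "a < b" "c < d"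
  shows "b \<le> c \<or> d \<le> a"
proof (rule ccontr)
  assume "\<not> (b \<le> c \<or> d \<le> a)"
  then have "(max a c + min b d) / 2 \<in> {a<..<b} \<inter> {c<..<d}"
    using assms(2,3) by (auto simp: max_def min_def)
  with assms(1) show False
    by blast
qed

lemma sum_measure_components_le:
  fixes U :: "'a::euclidean_space set"
  assumes "open U" "U \<in> lmeasurable" "I \<subseteq> components U" "finite I"
  shows "(\<Sum>C\<in>I. measure lebesgue C) \<le> measure lebesgue U"
proof -
  have I_sub: "C \<subseteq> U" if "C \<in> I" for C
    using that assms(3) in_components_subset by blast
  have I_meas: "C \<in> lmeasurable" if "C \<in> I" for C
  proof (rule fmeasurableI2[OF assms(2) I_sub[OF that]])
    have "open C"
      using that assms(3) by (intro open_components[OF assms(1)]) blast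
    then show "C \<in> sets lebesgue"
      by (simp add: borel_open sets_completionI_sets)
  qed
  have "pairwise disjnt I"
    using pairwise_subset[OF pairwise_disjoint_components assms(3)] by (auto simp: pairwise_def disjnt_def)
  then have "(\<Sum>C\<in>I. measure lebesgue C) = measure lebesgue (\<Union>I)"
    using assms(4) I_meas by (simp add: measure_Union')
  also have "\<dots> \<le> measure lebesgue U"
  proof (rule measure_mono_fmeasurable[OF _ _ assms(2)])
    show "\<Union>I \<subseteq> U"
      using I_sub by blast
    show "\<Union>I \<in> sets lebesgue"
      using assms(4) I_meas by (intro sets.finite_Union) auto
  qed
  finally show ?thesis .
qed

lemma components_subset_Ioo:
  fixes U :: "real set"
  assumes "open U" "U \<subseteq> {a<..<b}" "C \<in> components U"
  shows "C = {Inf C<..<Sup C}" and "a \<le> Inf C" and "Inf C < Sup C" and "Sup C \<le> b"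
proof -
  have "C \<subseteq> {a<..<b}"
    using in_components_subset[OF assms(3)] assms(2) by blast
  then show "C = {Inf C<..<Sup C}" "a \<le> Inf C" "Inf C < Sup C" "Sup C \<le> b"
    by (rule open_connected_subset_Ioo[OF open_components[OF assms(1,3)]
          in_components_connected[OF assms(3)] in_components_nonempty[OF assms(3)]])+
qed

lemma components_Ioo_separated:
  fixes U :: "real set"
  assumes U: "open U" "U \<subseteq> {a<..<b}" and C: "C \<in> components U" "C' \<in> components U" "C \<noteq> C'"
  shows "Sup C \<le> Inf C' \<or> Sup C' \<le> Inf C"
proof (rule disjoint_Ioo_separated)
  have "C \<inter> C' = {}"
    using components_nonoverlap C by blast
  then show "{Inf C<..<Sup C} \<inter> {Inf C'<..<Sup C'} = {}"
    by (simp only: components_subset_Ioo(1)[OF U C(1), symmetric]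
        components_subset_Ioo(1)[OF U C(2), symmetric])
  show "Inf C < Sup C" "Inf C' < Sup C'"
    using components_subset_Ioo(3)[OF U] C(1,2) by blast+
qed

lemma sum_length_components_le:
  fixes U :: "real set"
  assumes U: "open U" "U \<subseteq> {a<..<b}" and I: "I \<subseteq> components U" "finite I"
  shows "(\<Sum>C\<in>I. Sup C - Inf C) \<le> measure lebesgue U"
proof -
  have "(\<Sum>C\<in>I. Sup C - Inf C) = (\<Sum>C\<in>I. measure lebesgue C)"
  proof (rule sum.cong[OF refl])
    fix C assume "C \<in> I"
    then have C: "C \<in> components U"
      using I(1) by blast
    have "measure lebesgue {Inf C<..<Sup C} = Sup C - Inf C"
      using components_subset_Ioo(3)[OF U C] by (simp add: measure_def)
    then show "Sup C - Inf C = measure lebesgue C"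
      using components_subset_Ioo(1)[OF U C] by simp
  qed
  also have "\<dots> \<le> measure lebesgue U"
    using U I by (intro sum_measure_components_le lmeasurable_open bounded_subset[OF bounded_Ioo])
  finally show ?thesis .
qed

lemma countable_components:
  fixes U :: "'a::euclidean_space set"
  assumes "open U"
  shows "countable (components U)"
proof (rule countable_disjoint_open_subsets)
  show "open C" if "C \<in> components U" for C
    using open_components[OF assms] that by blast
  show "pairwise disjnt (components U)"
    using pairwise_disjoint_components[of U] unfolding pairwise_def disjnt_def by blast
qed

lemma abs_continuous_on_sum_measure_image:
  fixes G :: "real \<Rightarrow> real"
  assumes ac: "abs_continuous_on a b G" and "e > 0"
  shows "\<exists>\<delta>>0. \<forall>(I :: 'i set) l r. finite I \<longrightarrow> (\<forall>i\<in>I. a \<le> l i \<and> l i \<le> r i \<and> r i \<le> b) \<longrightarrow>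
       (\<forall>i\<in>I. \<forall>j\<in>I. i \<noteq> j \<longrightarrow> r i \<le> l j \<or> r j \<le> l i) \<longrightarrow>
       (\<Sum>i\<in>I. r i - l i) < \<delta> \<longrightarrow> (\<Sum>i\<in>I. measure lebesgue (G ` {l i..r i})) < e"
proof -
  obtain \<delta> where "\<delta> > 0" and \<delta>: "\<forall>(I :: 'i set) p q. finite I \<longrightarrow>
       (\<forall>i\<in>I. a \<le> p i \<and> p i \<le> q i \<and> q i \<le> b) \<longrightarrow>
       (\<forall>i\<in>I. \<forall>j\<in>I. i \<noteq> j \<longrightarrow> q i \<le> p j \<or> q j \<le> p i) \<longrightarrow>
       (\<Sum>i\<in>I. q i - p i) < \<delta> \<longrightarrow> (\<Sum>i\<in>I. norm (G (q i) - G (p i))) < e"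
    using abs_continuous_on_finite_family[OF ac \<open>e > 0\<close>] by (elim exE conjE)
  have cont: "continuous_on {a..b} G"
    by (rule abs_continuous_on_imp_continuous_on[OF ac])
  show ?thesis
  proof (intro exI[of _ \<delta>] conjI allI impI)
    fix I :: "'i set" and l r :: "'i \<Rightarrow> real"
    assume I: "finite I" and lr: "\<forall>i\<in>I. a \<le> l i \<and> l i \<le> r i \<and> r i \<le> b"
      and sep: "\<forall>i\<in>I. \<forall>j\<in>I. i \<noteq> j \<longrightarrow> r i \<le> l j \<or> r j \<le> l i"
      and len: "(\<Sum>i\<in>I. r i - l i) < \<delta>"
    have "\<exists>p q. l i \<le> p \<and> p \<le> q \<and> q \<le> r i \<and> measure lebesgue (G ` {l i..r i}) \<le> \<bar>G q - G p\<bar>"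
      if "i \<in> I" for i
      using lr that by (intro continuous_on_Icc_measure_image_le continuous_on_subset[OF cont]) auto
    then obtain p q where pq: "\<And>i. i \<in> I \<Longrightarrow> l i \<le> p i \<and> p i \<le> q i \<and> q i \<le> r i \<and>
        measure lebesgue (G ` {l i..r i}) \<le> \<bar>G (q i) - G (p i)\<bar>"
      by metis
    have "(\<Sum>i\<in>I. measure lebesgue (G ` {l i..r i})) \<le> (\<Sum>i\<in>I. norm (G (q i) - G (p i)))"
    proof (rule sum_mono)
      fix i assume "i \<in> I"
      then show "measure lebesgue (G ` {l i..r i}) \<le> norm (G (q i) - G (p i))"
        using pq by simp
    qed
    also have "\<dots> < e"
    proof (rule \<delta>[rule_format (no_asm)])
      have lpqr: "l i \<le> p i" "p i \<le> q i" "q i \<le> r i" if "i \<in> I" for i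
        using pq[OF that] by auto
      show "\<forall>i\<in>I. a \<le> p i \<and> p i \<le> q i \<and> q i \<le> b"
        using lr lpqr by (meson order_trans)
      show "\<forall>i\<in>I. \<forall>j\<in>I. i \<noteq> j \<longrightarrow> q i \<le> p j \<or> q j \<le> p i"
        using sep lpqr by (meson order_trans)
      have "(\<Sum>i\<in>I. q i - p i) \<le> (\<Sum>i\<in>I. r i - l i)"
        by (rule sum_mono) (use lpqr in fastforce)
      then show "(\<Sum>i\<in>I. q i - p i) < \<delta>"
        using len by linarith
    qed (rule I)
    finally show "(\<Sum>i\<in>I. measure lebesgue (G ` {l i..r i})) < e" .
  qed (rule \<open>\<delta> > 0\<close>)
qed

lemma abs_continuous_on_image_open_small:
  fixes G :: "real \<Rightarrow> real"
  assumes ac: "abs_continuous_on a b G" and "e > 0"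
  shows "\<exists>\<delta>>0. \<forall>U. open U \<and> U \<subseteq> {a<..<b} \<and> measure lebesgue U < \<delta> \<longrightarrow>
           (\<exists>T. G ` U \<subseteq> T \<and> T \<in> lmeasurable \<and> measure lebesgue T \<le> e)"
proof -
  obtain \<delta> where "\<delta> > 0" and \<delta>: "\<forall>(I :: real set set) l r. finite I \<longrightarrow>
       (\<forall>i\<in>I. a \<le> l i \<and> l i \<le> r i \<and> r i \<le> b) \<longrightarrow>
       (\<forall>i\<in>I. \<forall>j\<in>I. i \<noteq> j \<longrightarrow> r i \<le> l j \<or> r j \<le> l i) \<longrightarrow>
       (\<Sum>i\<in>I. r i - l i) < \<delta> \<longrightarrow> (\<Sum>i\<in>I. measure lebesgue (G ` {l i..r i})) < e"
    using abs_continuous_on_sum_measure_image[OF ac \<open>e > 0\<close>] by (elim exE conjE)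
  have cont: "continuous_on {a..b} G"
    by (rule abs_continuous_on_imp_continuous_on[OF ac])
  show ?thesis
  proof (intro exI[of _ \<delta>] conjI allI impI)
    fix U :: "real set"
    assume "open U \<and> U \<subseteq> {a<..<b} \<and> measure lebesgue U < \<delta>"
    then have U: "open U" "U \<subseteq> {a<..<b}" "measure lebesgue U < \<delta>"
      by blast+
    note C = components_subset_Ioo[OF U(1,2)]
    have C_Icc: "C \<subseteq> {Inf C..Sup C}" if "C \<in> components U" for C
      using C(1)[OF that] by (metis greaterThanLessThan_subseteq_atLeastAtMost_iff order_refl)
    define A where "A C = G ` {Inf C..Sup C}" for C
    have A_meas: "A C \<in> lmeasurable" if "C \<in> components U" for C
      unfolding A_def using C(2-4)[OF that]
      by (intro lmeasurable_compact compact_continuous_image continuous_on_subset[OF cont]) auto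
    have "measure lebesgue (\<Union>C\<in>I. A C) \<le> e" if I: "I \<subseteq> components U" "finite I" for I
    proof -
      have "measure lebesgue (\<Union>C\<in>I. A C) \<le> (\<Sum>C\<in>I. measure lebesgue (A C))"
        using A_meas I by (intro measure_UNION_le) auto
      also have "\<dots> < e"
        unfolding A_def
      proof (rule \<delta>[rule_format (no_asm)])
        show "\<forall>C\<in>I. a \<le> Inf C \<and> Inf C \<le> Sup C \<and> Sup C \<le> b"
          using C(2-4) I(1) by (meson less_imp_le subsetD)
        show "\<forall>C\<in>I. \<forall>C'\<in>I. C \<noteq> C' \<longrightarrow> Sup C \<le> Inf C' \<or> Sup C' \<le> Inf C"
          using components_Ioo_separated[OF U(1,2)] I(1) by blast
        show "(\<Sum>C\<in>I. Sup C - Inf C) < \<delta>"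
          using sum_length_components_le[OF U(1,2) I] U(3) by linarith
      qed (rule I(2))
      finally show ?thesis
        by simp
    qed
    then have "(\<Union>C\<in>components U. A C) \<in> lmeasurable" "measure lebesgue (\<Union>C\<in>components U. A C) \<le> e"
      using fmeasurable_UN_bound[of "components U" A lebesgue e]
        measure_UN_bound[of "components U" A lebesgue e] A_meas countable_components[OF U(1)]
      by auto
    moreover have "G ` U \<subseteq> (\<Union>C\<in>components U. A C)"
    proof
      fix y assume "y \<in> G ` U"
      then obtain x C where "C \<in> components U" "x \<in> C" "y = G x"
        using Union_components[of U] by blast
      then show "y \<in> (\<Union>C\<in>components U. A C)"
        using C_Icc unfolding A_def by blast
    qed
    ultimately show "\<exists>T. G ` U \<subseteq> T \<and> T \<in> lmeasurable \<and> measure lebesgue T \<le> e"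
      by blast
  qed (rule \<open>\<delta> > 0\<close>)
qed

lemma negligible_open_superset_small:
  fixes E :: "real set"
  assumes "negligible E" "E \<subseteq> {a<..<b}" "0 < \<delta>"
  obtains U where "open U" "E \<subseteq> U" "U \<subseteq> {a<..<b}" "measure lebesgue U < \<delta>"
proof -
  have E: "E \<in> lmeasurable" "measure lebesgue E = 0"
    using assms(1) negligible_iff_measure by blast+
  obtain V where V: "open V" "E \<subseteq> V" "V - E \<in> lmeasurable" "emeasure lebesgue (V - E) < ennreal \<delta>"
    using sets_lebesgue_outer_open[OF fmeasurableD[OF E(1)] \<open>0 < \<delta>\<close>] by blast
  define U where "U = V \<inter> {a<..<b}"
  have U: "open U" "E \<subseteq> U" "U \<subseteq> {a<..<b}"
    using V(1,2) assms(2) unfolding U_def by auto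
  have "ennreal (measure lebesgue (V - E)) < ennreal \<delta>"
    using V(3,4) by (simp add: emeasure_eq_measure2)
  then have "measure lebesgue (V - E) < \<delta>"
    by (simp add: ennreal_less_iff[OF measure_nonneg])
  have "U \<in> lmeasurable"
    using U(1,3) by (intro lmeasurable_open bounded_subset[OF bounded_Ioo])
  then have "measure lebesgue U \<le> measure lebesgue ((V - E) \<union> E)"
    using fmeasurable.Un[OF V(3) E(1)] unfolding U_def by (intro measure_mono_fmeasurable) auto
  also have "\<dots> \<le> measure lebesgue (V - E) + measure lebesgue E"
    using V(3) E(1) by (intro measure_Un_le) auto
  finally have "measure lebesgue U < \<delta>"
    using \<open>measure lebesgue (V - E) < \<delta>\<close> E(2) by linarith
  with U show ?thesis
    by (intro that) auto
qed

lemma abs_continuous_on_negligible_image: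
  fixes G :: "real \<Rightarrow> real"
  assumes ac: "abs_continuous_on a b G" and E: "negligible E" "E \<subseteq> {a..b}"
  shows "negligible (G ` E)"
proof -
  define E' where "E' = E \<inter> {a<..<b}"
  have E': "negligible E'" "E' \<subseteq> {a<..<b}"
    using negligible_subset[OF E(1)] unfolding E'_def by auto
  have "\<exists>T. G ` E' \<subseteq> T \<and> T \<in> lmeasurable \<and> measure lebesgue T \<le> e" if "e > 0" for e
  proof -
    obtain \<delta> where "\<delta> > 0" and \<delta>: "\<forall>U. open U \<and> U \<subseteq> {a<..<b} \<and> measure lebesgue U < \<delta> \<longrightarrow>
        (\<exists>T. G ` U \<subseteq> T \<and> T \<in> lmeasurable \<and> measure lebesgue T \<le> e)"
      using abs_continuous_on_image_open_small[OF ac \<open>e > 0\<close>] by (elim exE conjE)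
    obtain U where U: "open U" "E' \<subseteq> U" "U \<subseteq> {a<..<b}" "measure lebesgue U < \<delta>"
      using negligible_open_superset_small[OF E' \<open>\<delta> > 0\<close>] by blast
    then have "\<exists>T. G ` U \<subseteq> T \<and> T \<in> lmeasurable \<and> measure lebesgue T \<le> e"
      by (intro \<delta>[rule_format] conjI)
    then obtain T where T: "G ` U \<subseteq> T" "T \<in> lmeasurable" "measure lebesgue T \<le> e"
      by (elim exE conjE)
    have "G ` E' \<subseteq> T"
      using U(2) T(1) by blast
    with T(2,3) show ?thesis
      by (intro exI[of _ T] conjI)
  qed
  then have "negligible (G ` E')"
    unfolding negligible_outer_le by blast
  then have "negligible (G ` E' \<union> {G a, G b})"
    by (simp add: negligible_insert)
  moreover have "G ` E \<subseteq> G ` E' \<union> {G a, G b}"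
  proof
    fix y assume "y \<in> G ` E"
    then obtain x where "x \<in> E" "y = G x"
      by blast
    with E(2) have "x \<in> E' \<or> x = a \<or> x = b"
      unfolding E'_def by fastforce
    with \<open>y = G x\<close> show "y \<in> G ` E' \<union> {G a, G b}"
      by blast
  qed
  ultimately show ?thesis
    using negligible_subset by blast
qed

section \<open>Integrating an almost-everywhere derivative bound\<close>

lemma measure_vec1_image:
  fixes X :: "real set"
  assumes "(vec ` X :: (real^1) set) \<in> lmeasurable"
  shows "X \<in> lmeasurable \<and> measure lebesgue X = measure lebesgue (vec ` X :: (real^1) set)"
proof -
  have i: "(\<lambda>x::real^1. 1::real) integrable_on (vec ` X)"
    using assms lmeasurable_iff_integrable_on by blast
  have eq: "(\<lambda>x. x $ 1) ` (vec ` X :: (real^1) set) = X"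
    unfolding image_image by simp
  have "((\<lambda>x::real. 1::real) has_integral integral (vec ` X) (\<lambda>x::real^1. 1::real)) X"
    using has_integral_vec1_I[OF integrable_integral[OF i]] eq by (simp add: o_def)
  then have X: "X \<in> lmeasurable"
    unfolding lmeasurable_iff_integrable_on integrable_on_def by blast
  have "measure lebesgue X = integral X (\<lambda>x::real. 1::real)"
    by (rule lmeasure_integral[OF X])
  also have "\<dots> = integral (vec ` X) (\<lambda>x::real^1. 1::real)"
    using \<open>((\<lambda>x::real. 1::real) has_integral _) X\<close> by (rule integral_unique)
  also have "\<dots> = measure lebesgue (vec ` X :: (real^1) set)"
    by (rule lmeasure_integral[OF assms, symmetric])
  finally show ?thesis
    using X by blast
qed

(* The change of variables theory of HOL-Analysis is stated for real^'n; transport along vec. *)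
lemma measure_differentiable_image_real:
  fixes G G' :: "real \<Rightarrow> real"
  assumes S: "S \<in> sets lebesgue"
    and der: "\<And>x. x \<in> S \<Longrightarrow> (G has_real_derivative G' x) (at x within S)"
    and int: "(\<lambda>x. \<bar>G' x\<bar>) integrable_on S"
  shows "G ` S \<in> lmeasurable \<and> measure lebesgue (G ` S) \<le> integral S (\<lambda>x. \<bar>G' x\<bar>)"
proof -
  let ?lift = "vec :: real \<Rightarrow> real^1"
  let ?drop = "(\<lambda>x::real^1. x $ 1)"
  define T where "T = ?lift ` S"
  have T: "T \<in> sets lebesgue"
    unfolding T_def
    by (auto intro: differentiable_image_in_sets_lebesgue [OF S] differentiable_vec)
  have "((\<lambda>x. vec (G (x $ 1))) has_derivative (*\<^sub>R) (G' z)) (at (vec z) within ?lift ` S)"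
    if "z \<in> S" for z
    using der [OF that]
    by (simp add: has_real_derivative_iff_has_vector_derivative has_vector_derivative_def has_derivative_vector_1)
  then have der': "\<And>x. x \<in> T \<Longrightarrow>
        ((\<lambda>x. ?lift (G (?drop x))) has_derivative (*\<^sub>R) (G' (?drop x))) (at x within T)"
    by (auto simp: T_def)
  have dropT: "?drop ` T = S"
    by (force simp: T_def image_iff)
  have det1: "det (mat r :: real^1^1) = r" for r
    by (simp add: det_1 mat_def)
  have deteq: "\<bar>det (matrix ((*\<^sub>R) (G' (?drop x))) :: real^1^1)\<bar> = \<bar>G' (?drop x)\<bar>" for x
    unfolding matrix_scaleR det1 ..
  have int': "(\<lambda>x. \<bar>det (matrix ((*\<^sub>R) (G' (?drop x))) :: real^1^1)\<bar>) integrable_on T"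
  proof -
    have "((\<lambda>x::real^1. \<bar>G' (?drop x)\<bar>) \<circ> vec) integrable_on (?drop ` T)"
      using int dropT by (simp add: o_def)
    then obtain y where "(((\<lambda>x::real^1. \<bar>G' (?drop x)\<bar>) \<circ> vec) has_integral y) (?drop ` T)"
      by (auto simp: integrable_on_def)
    then have "((\<lambda>x::real^1. \<bar>G' (?drop x)\<bar>) has_integral y) T"
      by (rule has_integral_vec1_D)
    then show ?thesis
      unfolding deteq by (auto simp: integrable_on_def)
  qed
  have m: "(\<lambda>x. ?lift (G (?drop x))) ` T \<in> lmeasurable"
    and le: "measure lebesgue ((\<lambda>x. ?lift (G (?drop x))) ` T)
      \<le> integral T (\<lambda>x. \<bar>det (matrix ((*\<^sub>R) (G' (?drop x))) :: real^1^1)\<bar>)"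
    using measurable_differentiable_image[OF T der' int'] measure_differentiable_image[OF T der' int']
    by auto
  have imgeq: "(\<lambda>x. ?lift (G (?drop x))) ` T = ?lift ` (G ` S)"
    by (force simp: T_def image_iff)
  have inteq: "integral T (\<lambda>x. \<bar>det (matrix ((*\<^sub>R) (G' (?drop x))) :: real^1^1)\<bar>)
      = integral S (\<lambda>x. \<bar>G' x\<bar>)"
    unfolding deteq integral_vec1_eq[of T] dropT by (simp add: o_def)
  have "(vec ` (G ` S) :: (real^1) set) \<in> lmeasurable"
    using m imgeq by simp
  then have A: "G ` S \<in> lmeasurable"
    and B: "measure lebesgue (G ` S) = measure lebesgue (vec ` (G`S) :: (real^1) set)"
    using measure_vec1_image by blast+
  show ?thesis
    using A B le imgeq inteq by simp
qed

lemma continuous_on_last_crossing: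
  fixes G :: "real \<Rightarrow> real"
  assumes cont: "continuous_on {a..b} G" and ab: "a \<le> b" and y: "G a < y" "y < G b"
  obtains c where "c \<in> {a<..<b}" "G c = y" "\<And>x. x \<in> {c<..b} \<Longrightarrow> y < G x"
proof -
  define L where "L = {a..b} \<inter> G -` {..y}"
  have "closed L"
    unfolding L_def by (rule continuous_closed_preimage[OF cont]) auto
  moreover have "L \<noteq> {}"
    using y ab unfolding L_def by auto
  moreover have L_bdd: "bdd_above L"
    unfolding L_def by (auto intro: bdd_aboveI[of _ b])
  ultimately have "Sup L \<in> L"
    by (intro closed_contains_Sup)
  define c where "c = Sup L"
  have c: "a \<le> c" "c \<le> b" "G c \<le> y"
    using \<open>Sup L \<in> L\<close> unfolding c_def L_def by auto
  have above: "y < G x" if "x \<in> {c<..b}" for x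
  proof (rule ccontr)
    assume "\<not> y < G x"
    then have "x \<in> L"
      using that c unfolding L_def by auto
    then have "x \<le> c"
      unfolding c_def using L_bdd by (rule cSup_upper)
    then show False
      using that by auto
  qed
  have "c < b"
    using c y by (metis order.not_eq_order_implies_strict not_le)
  have "G c = y"
  proof (rule ccontr)
    assume "G c \<noteq> y"
    with c have "G c < y"
      by auto
    then obtain d where d: "d > 0" "\<And>x. x \<in> {a..b} \<Longrightarrow> dist x c < d \<Longrightarrow> dist (G x) (G c) < y - G c"
      using cont c(1,2) unfolding continuous_on_iff by (metis atLeastAtMost_iff diff_gt_0_iff_gt)
    define x where "x = min b (c + d / 2)"
    have x: "x \<in> {c<..b}" "x \<in> {a..b}" "dist x c < d"
      using \<open>c < b\<close> c d unfolding x_def by (auto simp: dist_real_def)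
    have "G x < y"
      using d(2)[OF x(2,3)] by (auto simp: dist_real_def)
    then show False
      using above[OF x(1)] by simp
  qed
  moreover have "a < c"
    using \<open>G c = y\<close> y c by (metis order.not_eq_order_implies_strict order_less_irrefl)
  ultimately show ?thesis
    using that \<open>c < b\<close> above by auto
qed

lemma has_real_derivative_nonneg_if_above_right:
  fixes G :: "real \<Rightarrow> real"
  assumes der: "(G has_real_derivative D) (at c within {a..b})" and c: "a \<le> c" "c < b"
    and incr: "\<And>x. x \<in> {c<..b} \<Longrightarrow> G c < G x"
  shows "0 \<le> D"
proof -
  have "(G has_real_derivative D) (at c within {c..b})"
    using der by (rule DERIV_subset) (use c in auto)
  then have "((\<lambda>x. (G x - G c) / (x - c)) \<longlongrightarrow> D) (at_right c)"
    using at_within_Icc_at_right[OF c(2)] by (simp add: has_field_derivative_iff)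
  moreover have "eventually (\<lambda>x. 0 \<le> (G x - G c) / (x - c)) (at_right c)"
    unfolding eventually_at_right_field
  proof (intro exI[of _ b] conjI allI impI)
    fix y assume "c < y" "y < b"
    then show "0 \<le> (G y - G c) / (y - c)"
      using incr[of y] by auto
  qed (rule c(2))
  ultimately show ?thesis
    by (rule tendsto_lowerbound) simp
qed

lemma has_real_derivative_difference_quotients:
  fixes G :: "real \<Rightarrow> real"
  assumes "(G has_real_derivative D) (at x)"
  shows "(\<lambda>n. real (Suc n) * (G (x + 1 / real (Suc n)) - G x)) \<longlonglongrightarrow> D"
proof -
  have "((\<lambda>y. (G y - G x) / (y - x)) \<longlongrightarrow> D) (at x)"
    using assms by (simp add: has_field_derivative_iff)
  moreover have "filterlim (\<lambda>n. x + 1 / real (Suc n)) (at x) sequentially"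
    unfolding filterlim_at
  proof
    show "\<forall>\<^sub>F n in sequentially. x + 1 / real (Suc n) \<in> UNIV \<and> x + 1 / real (Suc n) \<noteq> x"
      by simp
    have "(\<lambda>n. 1 / real (Suc n)) \<longlonglongrightarrow> 0"
      using LIMSEQ_inverse_real_of_nat by (simp add: inverse_eq_divide)
    then have "(\<lambda>n. x + 1 / real (Suc n)) \<longlonglongrightarrow> x + 0"
      by (intro tendsto_intros)
    then show "(\<lambda>n. x + 1 / real (Suc n)) \<longlonglongrightarrow> x"
      by simp
  qed
  ultimately have "(\<lambda>n. (G (x + 1 / real (Suc n)) - G x) / (x + 1 / real (Suc n) - x)) \<longlonglongrightarrow> D"
    by (rule filterlim_compose)
  then show ?thesis
    by (simp add: mult.commute)
qed

lemma borel_measurable_derivative_on: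
  fixes G G' :: "real \<Rightarrow> real"
  assumes ab: "a \<le> b" and cont: "continuous_on {a..b} G"
    and S: "S \<subseteq> {a<..<b}" "S \<in> sets lebesgue"
    and der: "\<And>x. x \<in> S \<Longrightarrow> (G has_real_derivative G' x) (at x)"
  shows "G' \<in> borel_measurable (lebesgue_on S)"
proof -
  \<comment> \<open>a continuous extension of G to the whole line, whose difference quotients are continuous\<close>
  define Ge where "Ge y = G (max a (min b y))" for y
  have "continuous_on UNIV Ge"
    unfolding Ge_def
    by (rule continuous_on_compose2[OF cont]) (use ab in \<open>auto intro!: continuous_intros\<close>)
  then have "continuous_on UNIV (\<lambda>x. real (Suc n) * (Ge (x + 1 / real (Suc n)) - Ge x))" for n
    by (auto intro!: continuous_intros continuous_on_compose2[of UNIV Ge])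
  then have Dq_meas: "(\<lambda>x. real (Suc n) * (Ge (x + 1 / real (Suc n)) - Ge x))
      \<in> borel_measurable (lebesgue_on S)" for n
    by (rule continuous_imp_measurable_on_sets_lebesgue[OF continuous_on_subset S(2)]) simp
  show ?thesis
  proof (rule borel_measurable_LIMSEQ_real[OF _ Dq_meas])
    fix x assume "x \<in> space (lebesgue_on S)"
    then have "x \<in> {a<..<b}" "x \<in> S"
      using S by auto
    have "(Ge has_real_derivative G' x) (at x)"
      by (rule has_field_derivative_transform_within_open[OF der[OF \<open>x \<in> S\<close>] _ \<open>x \<in> {a<..<b}\<close>])
        (auto simp: Ge_def)
    then show "(\<lambda>n. real (Suc n) * (Ge (x + 1 / real (Suc n)) - Ge x)) \<longlonglongrightarrow> G' x"
      by (rule has_real_derivative_difference_quotients)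
  qed
qed

lemma measure_image_le_integral_of_deriv_bound:
  fixes G G' h :: "real \<Rightarrow> real"
  assumes S: "S \<subseteq> {a..b}" "S \<in> sets lebesgue"
    and der: "\<And>x. x \<in> S \<Longrightarrow> (G has_real_derivative G' x) (at x within S)"
    and G'_meas: "G' \<in> borel_measurable (lebesgue_on S)"
    and bound: "\<And>x. x \<in> S \<Longrightarrow> \<bar>G' x\<bar> \<le> h x"
    and h: "h integrable_on {a..b}" and h_nonneg: "\<And>x. x \<in> {a..b} \<Longrightarrow> 0 \<le> h x"
  shows "G ` S \<in> lmeasurable" and "measure lebesgue (G ` S) \<le> integral {a..b} h"
proof -
  have "h absolutely_integrable_on {a..b}"
    by (rule nonnegative_absolutely_integrable_1[OF h h_nonneg])
  then have hS: "h integrable_on S"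
    by (rule set_lebesgue_integral_eq_integral(1)[OF set_integrable_subset[OF _ S(2) S(1)]])
  have G'_int: "(\<lambda>x. \<bar>G' x\<bar>) integrable_on S"
  proof (rule measurable_bounded_by_integrable_imp_integrable[OF _ hS _ S(2)])
    show "(\<lambda>x. \<bar>G' x\<bar>) \<in> borel_measurable (lebesgue_on S)"
      using G'_meas by measurable
    show "norm \<bar>G' x\<bar> \<le> h x" if "x \<in> S" for x
      using bound[OF that] by simp
  qed
  note image = measure_differentiable_image_real[OF S(2) der G'_int]
  show "G ` S \<in> lmeasurable"
    using image by (rule conjunct1)
  have "measure lebesgue (G ` S) \<le> integral S (\<lambda>x. \<bar>G' x\<bar>)"
    using image by (rule conjunct2)
  also have "\<dots> \<le> integral S h"
    by (rule integral_le[OF G'_int hS]) (rule bound)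
  also have "\<dots> \<le> integral {a..b} h"
    by (rule integral_subset_le[OF S(1) hS h]) (use h_nonneg in auto)
  finally show "measure lebesgue (G ` S) \<le> integral {a..b} h" .
qed

lemma Ioo_subset_image_upcrossings:
  fixes G G' :: "real \<Rightarrow> real"
  assumes ab: "a \<le> b" and cont: "continuous_on {a..b} G"
    and der: "\<And>x. x \<in> {a<..<b} - N \<Longrightarrow> (G has_real_derivative G' x) (at x)"
  shows "{G a<..<G b} \<subseteq> G ` (N \<inter> {a..b}) \<union> G ` {x \<in> {a<..<b} - N. 0 \<le> G' x}"
proof
  fix y assume "y \<in> {G a<..<G b}"
  then have y: "G a < y" "y < G b"
    by auto
  obtain c where c: "c \<in> {a<..<b}" "G c = y" "\<And>x. x \<in> {c<..b} \<Longrightarrow> y < G x"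
    using continuous_on_last_crossing[OF cont ab y] by blast
  show "y \<in> G ` (N \<inter> {a..b}) \<union> G ` {x \<in> {a<..<b} - N. 0 \<le> G' x}"
  proof (cases "c \<in> N")
    case True
    then show ?thesis
      using c(1,2) by auto
  next
    case False
    with c(1) have c_good: "c \<in> {a<..<b} - N"
      by simp
    have "0 \<le> G' c"
      using has_field_derivative_at_within[OF der[OF c_good]] c
      by (intro has_real_derivative_nonneg_if_above_right) auto
    with c_good c(2) show ?thesis
      by blast
  qed
qed

(* Each value between G a and G b is taken either on the null set N, whose image is null by the
   Luzin N property, or at a point where G crosses it upwards, so that G' >= 0 there. *)
lemma abs_continuous_on_diff_le_integral_off_negligible:
  fixes G G' h :: "real \<Rightarrow> real"
  assumes ab: "a \<le> b" and ac: "abs_continuous_on a b G" and N: "negligible N"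
    and der: "\<And>x. x \<in> {a<..<b} - N \<Longrightarrow> (G has_real_derivative G' x) (at x)"
    and le: "\<And>x. x \<in> {a<..<b} - N \<Longrightarrow> G' x \<le> h x"
    and h: "h integrable_on {a..b}" and h_nonneg: "\<And>x. x \<in> {a..b} \<Longrightarrow> 0 \<le> h x"
  shows "G b - G a \<le> integral {a..b} h"
proof (cases "G a < G b")
  case False
  then show ?thesis
    using integral_nonneg[OF h h_nonneg] by linarith
next
  case True
  have cont: "continuous_on {a..b} G"
    by (rule abs_continuous_on_imp_continuous_on[OF ac])
  define S where "S = {a<..<b} - N"
  have S_meas: "S \<in> sets lebesgue"
    unfolding S_def
    by (intro sets.Diff negligible_imp_sets[OF N] sets_completionI_sets) simp
  have G'_S: "G' \<in> borel_measurable (lebesgue_on S)"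
    by (rule borel_measurable_derivative_on[OF ab cont _ S_meas]) (use der in \<open>auto simp: S_def\<close>)
  define P where "P = {x \<in> S. 0 \<le> G' x}"
  have "G' -` {0..} \<inter> space (lebesgue_on S) \<in> sets (lebesgue_on S)"
    by (rule measurable_sets[OF G'_S]) simp
  moreover have "G' -` {0..} \<inter> space (lebesgue_on S) = P"
    unfolding P_def using S_meas by auto
  ultimately have P_meas: "P \<in> sets lebesgue"
    using S_meas by (simp add: sets_restrict_space_iff)
  have G'_P: "G' \<in> borel_measurable (lebesgue_on P)"
    by (rule borel_measurable_derivative_on[OF ab cont _ P_meas]) (use der in \<open>auto simp: P_def S_def\<close>)
  have P_der: "(G has_real_derivative G' x) (at x within P)" if "x \<in> P" for x
    using der that unfolding P_def S_def by (blast intro: has_field_derivative_at_within)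
  have P_bound: "\<bar>G' x\<bar> \<le> h x" if "x \<in> P" for x
    using le that unfolding P_def S_def by fastforce
  have P_sub: "P \<subseteq> {a..b}"
    unfolding P_def S_def by auto
  note P = measure_image_le_integral_of_deriv_bound[OF P_sub P_meas P_der G'_P P_bound h h_nonneg]
  have "negligible (G ` (N \<inter> {a..b}))"
    by (rule abs_continuous_on_negligible_image[OF ac]) (use negligible_subset[OF N] in auto)
  then have null: "G ` (N \<inter> {a..b}) \<in> lmeasurable" "measure lebesgue (G ` (N \<inter> {a..b})) = 0"
    using negligible_iff_measure by blast+
  have "G b - G a = measure lebesgue {G a<..<G b}"
    using True by (simp add: measure_def)
  also have "\<dots> \<le> measure lebesgue (G ` (N \<inter> {a..b}) \<union> G ` P)"
  proof (rule measure_mono_fmeasurable)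
    show "{G a<..<G b} \<subseteq> G ` (N \<inter> {a..b}) \<union> G ` P"
      using Ioo_subset_image_upcrossings[OF ab cont der] unfolding P_def S_def .
  qed (use fmeasurable.Un[OF null(1) P(1)] in auto)
  also have "\<dots> \<le> measure lebesgue (G ` (N \<inter> {a..b})) + measure lebesgue (G ` P)"
    using null(1) P(1) by (intro measure_Un_le) auto
  finally show ?thesis
    using null(2) P(2) by linarith
qed

lemma abs_continuous_on_diff_le_integral:
  fixes G h :: "real \<Rightarrow> real"
  assumes ab: "a \<le> b" and ac: "abs_continuous_on a b G"
    and der: "AE x in lborel. x \<in> {a..b} \<longrightarrow>
      (\<exists>D. (G has_real_derivative D) (at x within {a..b}) \<and> D \<le> h x)"
    and h: "h integrable_on {a..b}" and h_nonneg: "\<And>x. x \<in> {a..b} \<Longrightarrow> 0 \<le> h x"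
  shows "G b - G a \<le> integral {a..b} h"
proof -
  obtain N where N: "{x \<in> space lborel. \<not> (x \<in> {a..b} \<longrightarrow>
      (\<exists>D. (G has_real_derivative D) (at x within {a..b}) \<and> D \<le> h x))} \<subseteq> N"
    "emeasure lborel N = 0" "N \<in> sets lborel"
    using der by (rule AE_E)
  have "negligible N"
    using N(2,3) unfolding negligible_iff_null_sets by (auto intro: null_sets_completionI)
  have good: "\<exists>D. (G has_real_derivative D) (at x) \<and> D \<le> h x" if x: "x \<in> {a<..<b} - N" for x
  proof -
    have "x \<notin> {x \<in> space lborel. \<not> (x \<in> {a..b} \<longrightarrow>
        (\<exists>D. (G has_real_derivative D) (at x within {a..b}) \<and> D \<le> h x))}"
      using N(1) x by blast
    then have "\<exists>D. (G has_real_derivative D) (at x within {a..b}) \<and> D \<le> h x"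
      using x by simp
    moreover have "at x within {a..b} = at x"
      using x by (intro at_within_interior) auto
    ultimately show ?thesis
      by simp
  qed
  define G' where "G' x = (SOME D. (G has_real_derivative D) (at x) \<and> D \<le> h x)" for x
  have "(G has_real_derivative G' x) (at x) \<and> G' x \<le> h x" if "x \<in> {a<..<b} - N" for x
    unfolding G'_def by (rule someI_ex[OF good[OF that]])
  then show ?thesis
    by (intro abs_continuous_on_diff_le_integral_off_negligible[OF ab ac \<open>negligible N\<close> _ _ h h_nonneg])
      auto
qed

section \<open>The Herglotz vector field and the evolution family\<close>

lemma Re_set_lebesgue_integral_nonpos:
  fixes f :: "real \<Rightarrow> complex"
  assumes "\<And>x. x \<in> A \<Longrightarrow> Re (f x) \<le> 0"
  shows "Re (set_lebesgue_integral M A f) \<le> 0"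
proof -
  let ?g = "\<lambda>x. indicator A x *\<^sub>R f x"
  have g_nonpos: "Re (?g x) \<le> 0" for x
    using assms[of x] by (auto simp: indicator_def)
  show ?thesis
  proof (cases "integrable M ?g")
    case True
    have "Re (integral\<^sup>L M ?g) = (LINT x|M. Re (?g x))"
      by (rule integral_Re[OF True, symmetric])
    also have "\<dots> \<le> (LINT x|M. 0)"
      by (rule integral_mono[OF integrable_Re[OF True]]) (use g_nonpos in auto)
    finally show ?thesis
      by (simp add: set_lebesgue_integral_def)
  next
    case False
    then show ?thesis
      by (simp add: set_lebesgue_integral_def not_integrable_integral_eq)
  qed
qed

lemma Re_herglotz_phi_le:
  assumes "Re \<zeta> > 0" "q r \<ge> 0"
  shows "Re (herglotz_phi q d \<pi> \<zeta> r) \<le> d r * Re \<zeta>"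
proof -
  have "Re (set_lebesgue_integral (\<pi> r) {0<..} (\<lambda>x. exp (- \<zeta> * complex_of_real x) - 1)) \<le> 0"
  proof (rule Re_set_lebesgue_integral_nonpos)
    fix x :: real assume "x \<in> {0<..}"
    have "Re (exp (- \<zeta> * complex_of_real x)) \<le> cmod (exp (- \<zeta> * complex_of_real x))"
      by (rule complex_Re_le_cmod)
    also have "\<dots> = exp (- Re \<zeta> * x)"
      by (simp add: norm_exp_eq_Re)
    also have "\<dots> \<le> 1"
      using assms(1) \<open>x \<in> {0<..}\<close> by simp
    finally show "Re (exp (- \<zeta> * complex_of_real x) - 1) \<le> 0"
      by simp
  qed
  then show ?thesis
    using assms(2) unfolding herglotz_phi_def by simp
qed

lemma abs_ln_diff_le:
  fixes m x y :: real
  assumes "0 < m" "m \<le> x" "m \<le> y"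
  shows "\<bar>ln y - ln x\<bar> \<le> \<bar>y - x\<bar> / m"
proof -
  have one_sided: "ln u - ln w \<le> \<bar>u - w\<bar> / m" if "m \<le> u" "m \<le> w" for u w :: real
  proof -
    have "0 < u" "0 < w"
      using that \<open>0 < m\<close> by linarith+
    then have "ln u - ln w \<le> (u - w) / w"
      by (rule ln_diff_le)
    also have "\<dots> \<le> \<bar>u - w\<bar> / m"
    proof (cases "u \<le> w")
      case True
      then have "(u - w) / w \<le> 0"
        using \<open>0 < w\<close> by (simp add: divide_nonpos_pos)
      also have "0 \<le> \<bar>u - w\<bar> / m"
        using \<open>0 < m\<close> by simp
      finally show ?thesis .
    next
      case False
      then show ?thesis
        using that \<open>0 < m\<close> by (simp add: frac_le)
    qed
    finally show ?thesis .
  qed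
  show ?thesis
    using one_sided[of y x] one_sided[of x y] assms(2,3) by (simp add: abs_minus_commute)
qed

lemma abs_continuous_on_ln_Re:
  fixes f :: "real \<Rightarrow> complex"
  assumes ac: "abs_continuous_on a b f" and cd: "a \<le> c" "d \<le> b" and "0 < m"
    and pos: "\<And>r. r \<in> {c..d} \<Longrightarrow> m \<le> Re (f r)"
  shows "abs_continuous_on c d (\<lambda>r. ln (Re (f r)))"
proof (rule abs_continuous_on_lipschitz_comp[OF ac cd])
  show "0 < 1 / m"
    using \<open>0 < m\<close> by simp
  fix x y assume "x \<in> {c..d}" "y \<in> {c..d}"
  then have "norm (ln (Re (f y)) - ln (Re (f x))) \<le> \<bar>Re (f y) - Re (f x)\<bar> / m"
    using abs_ln_diff_le[OF \<open>0 < m\<close> pos pos] by simp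
  also have "\<dots> \<le> norm (f y - f x) / m"
    using \<open>0 < m\<close> abs_Re_le_cmod[of "f y - f x"] by (simp add: divide_right_mono)
  finally show "norm (ln (Re (f y)) - ln (Re (f x))) \<le> 1 / m * norm (f y - f x)"
    by simp
qed

lemma ln_Re_herglotz_flow_deriv_le:
  fixes f :: "real \<Rightarrow> complex"
  assumes der: "(f has_vector_derivative herglotz_phi q d \<pi> (f r) r) (at r within S)"
    and pos: "0 < Re (f r)" and "0 \<le> q r"
  shows "\<exists>D. ((\<lambda>r. ln (Re (f r))) has_real_derivative D) (at r within S) \<and> D \<le> d r"
proof -
  let ?\<phi> = "herglotz_phi q d \<pi> (f r) r"
  have "((\<lambda>r. Re (f r)) has_real_derivative Re ?\<phi>) (at r within S)"
    using der by (rule has_field_derivative_Re)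
  then have "((\<lambda>r. ln (Re (f r))) has_real_derivative inverse (Re (f r)) * Re ?\<phi>) (at r within S)"
    by (rule DERIV_chain2[where g = "\<lambda>r. Re (f r)", OF DERIV_ln[OF pos]])
  moreover have "inverse (Re (f r)) * Re ?\<phi> \<le> inverse (Re (f r)) * (d r * Re (f r))"
    using Re_herglotz_phi_le[where q = q and r = r, OF pos \<open>0 \<le> q r\<close>] pos
    by (intro mult_left_mono) auto
  moreover have "inverse (Re (f r)) * (d r * Re (f r)) = d r"
    using pos by simp
  ultimately show ?thesis
    by (metis order_trans order_refl)
qed

lemma reverse_evolution_familyD:
  assumes "reverse_evolution_family \<phi> v" "0 \<le> t" "\<zeta> \<in> right_half_plane"
  shows "v t t \<zeta> = \<zeta>" and "\<And>r. r \<in> {0..t} \<Longrightarrow> 0 < Re (v r t \<zeta>)"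
    and "abs_continuous_on 0 t (\<lambda>r. v r t \<zeta>)"
    and "AE r in lborel. r \<in> {0..t} \<longrightarrow>
      ((\<lambda>r. v r t \<zeta>) has_vector_derivative \<phi> (v r t \<zeta>) r) (at r within {0..t})"
  using assms unfolding reverse_evolution_family_def right_half_plane_def by auto

lemma reverse_evolution_family_ln_Re_deriv_le:
  fixes q d :: "real \<Rightarrow> real" and \<pi> :: "real \<Rightarrow> real measure"
    and v :: "real \<Rightarrow> real \<Rightarrow> complex \<Rightarrow> complex"
  assumes q_nonneg: "\<forall>t\<ge>0. q t \<ge> 0"
    and v_ev: "reverse_evolution_family (herglotz_phi q d \<pi>) v"
    and st: "0 \<le> s" "s \<le> t" and \<zeta>: "\<zeta> \<in> right_half_plane"
  shows "AE r in lborel. r \<in> {s..t} \<longrightarrow>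
    (\<exists>D. ((\<lambda>r. ln (Re (v r t \<zeta>))) has_real_derivative D) (at r within {s..t}) \<and> D \<le> \<bar>d r\<bar>)"
proof -
  have t: "0 \<le> t"
    using st by linarith
  show ?thesis
    using reverse_evolution_familyD(4)[OF v_ev t \<zeta>]
  proof (rule AE_mp, intro AE_I2 impI)
    fix r assume r: "r \<in> {s..t}" and "r \<in> {0..t} \<longrightarrow> ((\<lambda>r. v r t \<zeta>) has_vector_derivative
      herglotz_phi q d \<pi> (v r t \<zeta>) r) (at r within {0..t})"
    then have "((\<lambda>r. v r t \<zeta>) has_vector_derivative herglotz_phi q d \<pi> (v r t \<zeta>) r) (at r within {s..t})"
      using st by (auto intro: has_vector_derivative_within_subset)
    moreover have "0 < Re (v r t \<zeta>)" "0 \<le> q r"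
      using reverse_evolution_familyD(2)[OF v_ev t \<zeta>] q_nonneg r st by auto
    ultimately obtain D where "((\<lambda>r. ln (Re (v r t \<zeta>))) has_real_derivative D) (at r within {s..t})" "D \<le> d r"
      using ln_Re_herglotz_flow_deriv_le by blast
    then show "\<exists>D. ((\<lambda>r. ln (Re (v r t \<zeta>))) has_real_derivative D) (at r within {s..t}) \<and> D \<le> \<bar>d r\<bar>"
      by force
  qed
qed

lemma reverse_evolution_family_Re_lower_bound:
  fixes q d :: "real \<Rightarrow> real" and \<pi> :: "real \<Rightarrow> real measure"
    and v :: "real \<Rightarrow> real \<Rightarrow> complex \<Rightarrow> complex"
  assumes q_nonneg: "\<forall>t\<ge>0. q t \<ge> 0"
    and v_ev: "reverse_evolution_family (herglotz_phi q d \<pi>) v"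
    and st: "0 \<le> s" "s \<le> t" and \<zeta>: "\<zeta> \<in> right_half_plane"
    and d_int: "(\<lambda>r. \<bar>d r\<bar>) integrable_on {s..t}"
  shows "Re \<zeta> * exp (- integral {s..t} (\<lambda>r. \<bar>d r\<bar>)) \<le> Re (v s t \<zeta>)"
proof -
  have t: "0 \<le> t"
    using st by linarith
  define u where "u r = Re (v r t \<zeta>)" for r
  have u_pos: "0 < u r" if "r \<in> {0..t}" for r
    unfolding u_def by (rule reverse_evolution_familyD(2)[OF v_ev t \<zeta> that])
  have ac: "abs_continuous_on 0 t (\<lambda>r. v r t \<zeta>)"
    by (rule reverse_evolution_familyD(3)[OF v_ev t \<zeta>])
  have "continuous_on {s..t} u"
    unfolding u_def using st
    by (intro continuous_on_Re continuous_on_subset[OF abs_continuous_on_imp_continuous_on[OF ac]]) auto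
  then obtain r0 where r0: "r0 \<in> {s..t}" "\<forall>r\<in>{s..t}. u r0 \<le> u r"
    using continuous_attains_inf[OF compact_Icc _ \<open>continuous_on {s..t} u\<close>] st by auto
  have "abs_continuous_on s t (\<lambda>r. ln (u r))"
    unfolding u_def using r0 st u_pos[of r0]
    by (intro abs_continuous_on_ln_Re[OF ac, of s t "u r0"]) (auto simp: u_def)
  then have "ln (u t) - ln (u s) \<le> integral {s..t} (\<lambda>r. \<bar>d r\<bar>)"
    using abs_continuous_on_diff_le_integral[OF st(2) _ _ d_int]
      reverse_evolution_family_ln_Re_deriv_le[OF q_nonneg v_ev st \<zeta>]
    unfolding u_def by simp
  moreover have "u t = Re \<zeta>" "0 < u s" "0 < Re \<zeta>"
    using reverse_evolution_familyD(1)[OF v_ev t \<zeta>] u_pos st \<zeta>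
    unfolding u_def right_half_plane_def by auto
  ultimately have "ln (Re \<zeta>) - integral {s..t} (\<lambda>r. \<bar>d r\<bar>) \<le> ln (u s)"
    by simp
  then have "exp (ln (Re \<zeta>) - integral {s..t} (\<lambda>r. \<bar>d r\<bar>)) \<le> u s"
    using \<open>0 < u s\<close> by (metis exp_le_cancel_iff exp_ln)
  then show ?thesis
    using \<open>0 < Re \<zeta>\<close> by (simp add: exp_diff exp_minus divide_inverse u_def)
qed

section \<open>Extinction of the branching process\<close>

lemma branching_kernels_measure_zero_le:
  fixes v :: "real \<Rightarrow> real \<Rightarrow> complex \<Rightarrow> complex"
    and k :: "real \<Rightarrow> real \<Rightarrow> ennreal \<Rightarrow> ennreal measure"
  assumes kernels: "branching_kernels v k" and st: "0 \<le> s" "s \<le> t"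
    and x: "0 < x" "x < \<infinity>" and \<theta>: "0 < \<theta>"
  shows "measure (k s t x) {0} \<le> exp (- enn2real x * Re (v s t (complex_of_real \<theta>)))"
proof -
  have K: "prob_space (k s t x)" "sets (k s t x) = sets borel"
    using kernels st unfolding branching_kernels_def by blast+
  have laplace: "complex_of_real (set_lebesgue_integral (k s t x) {y. y \<noteq> \<infinity>} (\<lambda>y. exp (- \<theta> * enn2real y)))
      = exp (- complex_of_real (enn2real x) * v s t (complex_of_real \<theta>))"
    using kernels st x \<theta> unfolding branching_kernels_def by blast
  interpret K: prob_space "k s t x"
    by (rule K(1))
  define f where "f y = indicator {y. y \<noteq> \<infinity>} y *\<^sub>R exp (- \<theta> * enn2real y)" for y :: ennreal
  have f_int: "integrable (k s t x) f"
  proof (rule K.integrable_const_bound[where B = 1])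
    show "AE y in k s t x. norm (f y) \<le> 1"
      using \<theta> by (intro AE_I2) (auto simp: f_def indicator_def enn2real_nonneg)
    show "f \<in> borel_measurable (k s t x)"
      unfolding f_def measurable_cong_sets[OF K(2) refl] by measurable
  qed
  have zero_meas: "{0} \<in> sets (k s t x)"
    using K(2) by simp
  have "measure (k s t x) {0} = (LINT y|k s t x. indicator {0} y)"
    using zero_meas by (simp add: K.emeasure_eq_measure)
  also have "\<dots> \<le> (LINT y|k s t x. f y)"
  proof (rule integral_mono)
    show "integrable (k s t x) (indicator {0} :: ennreal \<Rightarrow> real)"
      using zero_meas by (simp add: K.emeasure_eq_measure)
    show "indicator {0} y \<le> f y" for y
      by (cases "y = 0") (auto simp: f_def indicator_def)
  qed (rule f_int)
  also have "\<dots> = set_lebesgue_integral (k s t x) {y. y \<noteq> \<infinity>} (\<lambda>y. exp (- \<theta> * enn2real y))"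
    unfolding f_def set_lebesgue_integral_def ..
  also have "\<dots> \<le> cmod (exp (- complex_of_real (enn2real x) * v s t (complex_of_real \<theta>)))"
    unfolding laplace[symmetric] by simp
  also have "\<dots> = exp (- enn2real x * Re (v s t (complex_of_real \<theta>)))"
    by (simp add: norm_exp_eq_Re)
  finally show ?thesis .
qed

lemma branching_kernels_no_mass_at_zero:
  fixes v :: "real \<Rightarrow> real \<Rightarrow> complex \<Rightarrow> complex"
    and k :: "real \<Rightarrow> real \<Rightarrow> ennreal \<Rightarrow> ennreal measure"
  assumes kernels: "branching_kernels v k" and st: "0 \<le> s" "s \<le> t" and x: "0 < x"
    and "0 < c" and v_lower: "\<And>\<theta>. 0 < \<theta> \<Longrightarrow> \<theta> * c \<le> Re (v s t (complex_of_real \<theta>))"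
  shows "measure (k s t x) {0} = 0"
proof (cases "x = \<infinity>")
  case True
  moreover have "k s t \<infinity> = return borel \<infinity>"
    using kernels st unfolding branching_kernels_def by blast
  ultimately show ?thesis
    by (simp add: measure_return)
next
  case False
  then have x_fin: "x < \<infinity>"
    by (simp add: less_top)
  define \<xi> where "\<xi> = enn2real x"
  have "0 < \<xi>"
    using x x_fin unfolding \<xi>_def by (simp add: enn2real_positive_iff less_top)
  define m where "m = measure (k s t x) {0}"
  have bound: "m \<le> exp (- \<xi> * (\<theta> * c))" if "0 < \<theta>" for \<theta>
  proof -
    have "m \<le> exp (- \<xi> * Re (v s t (complex_of_real \<theta>)))"
      unfolding m_def \<xi>_def by (rule branching_kernels_measure_zero_le[OF kernels st x x_fin that])
    also have "\<dots> \<le> exp (- \<xi> * (\<theta> * c))"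
      using v_lower[OF that] \<open>0 < \<xi>\<close> by simp
    finally show ?thesis .
  qed
  show ?thesis
  proof (rule ccontr)
    assume "measure (k s t x) {0} \<noteq> 0"
    then have "0 < m"
      unfolding m_def using measure_nonneg[of "k s t x" "{0}"] by linarith
    define \<theta> where "\<theta> = (\<bar>ln m\<bar> + 1) / (\<xi> * c)"
    have "0 < \<theta>"
      unfolding \<theta>_def using \<open>0 < \<xi>\<close> \<open>0 < c\<close> by (simp add: add_pos_nonneg)
    have "\<xi> * (\<theta> * c) = \<bar>ln m\<bar> + 1"
      unfolding \<theta>_def using \<open>0 < \<xi>\<close> \<open>0 < c\<close> by (simp add: field_simps)
    then have "exp (- \<xi> * (\<theta> * c)) = exp (- (\<bar>ln m\<bar> + 1))"
      by simp
    also have "\<dots> < exp (ln m)"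
      by simp
    also have "\<dots> = m"
      using \<open>0 < m\<close> by simp
    finally show False
      using bound[OF \<open>0 < \<theta>\<close>] by linarith
  qed
qed

lemma branching_process_zero_null:
  fixes k :: "real \<Rightarrow> real \<Rightarrow> ennreal \<Rightarrow> ennreal measure"
    and P :: "real \<Rightarrow> ennreal \<Rightarrow> 'w measure" and Z :: "real \<Rightarrow> 'w \<Rightarrow> ennreal"
  assumes process: "branching_process k P Z" and st: "0 \<le> s" "s \<le> t"
    and no_mass: "measure (k s t x) {0} = 0"
  shows "{w \<in> space (P s x). Z t w = 0} \<in> null_sets (P s x)"
proof -
  let ?M = "P s x"
  have M: "prob_space ?M" "\<And>t. Z t \<in> borel_measurable ?M"
    "emeasure ?M {w \<in> space ?M. Z s w = x} = 1"
    "\<And>r t B A. s \<le> r \<Longrightarrow> r \<le> t \<Longrightarrow> B \<in> sets borel \<Longrightarrow>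
       A \<in> sigma_sets (space ?M) (\<Union>u\<in>{s..r}. {Z u -` C \<inter> space ?M | C. C \<in> sets borel}) \<Longrightarrow>
       measure ?M (A \<inter> {w \<in> space ?M. Z t w \<in> B})
         = set_lebesgue_integral ?M A (\<lambda>w. measure (k r t (Z r w)) B)"
    using process st(1) unfolding branching_process_def by blast+
  interpret M: prob_space ?M
    by (rule M(1))
  have zero_meas: "{w \<in> space ?M. Z t w = 0} \<in> sets ?M"
    using measurable_sets[OF M(2), of "{0}" t] by (simp add: vimage_def Int_def conj_commute)
  have "measure ?M {w \<in> space ?M. Z s w = x} = 1"
    using M(3) by (simp add: M.emeasure_eq_measure)
  then have start: "AE w in ?M. Z s w = x"
    using M.AE_prob_1 by force
  have "measure ?M {w \<in> space ?M. Z t w = 0} = measure ?M (space ?M \<inter> {w \<in> space ?M. Z t w \<in> {0}})"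
    by (rule arg_cong[where f = "measure ?M"]) auto
  also have "\<dots> = set_lebesgue_integral ?M (space ?M) (\<lambda>w. measure (k s t (Z s w)) {0})"
    by (rule M(4)[OF order_refl st(2)]) (auto intro: sigma_sets_top)
  also have "\<dots> = 0"
    unfolding set_lebesgue_integral_def
    by (rule integral_eq_zero_AE) (use start in \<open>eventually_elim, simp add: no_mass\<close>)
  finally show ?thesis
    using zero_meas by (simp add: M.emeasure_eq_measure null_setsI)
qed

lemma hit_zero_less_infinity_iff:
  fixes Z :: "real \<Rightarrow> 'w \<Rightarrow> ennreal"
  assumes path: "cadlag_absorbed (\<lambda>t. Z t w)" and "0 \<le> s"
  shows "hit_zero Z s w < \<infinity> \<longleftrightarrow> (\<exists>n::nat. Z (s + real n) w = 0)"
proof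
  assume "hit_zero Z s w < \<infinity>"
  then have "{t. s \<le> t \<and> Z t w = 0} \<noteq> {}"
    unfolding hit_zero_def by (metis Inf_empty image_empty less_irrefl top_ereal_def)
  then obtain t0 where t0: "s \<le> t0" "Z t0 w = 0"
    by blast
  have "\<forall>u\<ge>t0. Z u w = 0"
    using path t0 \<open>0 \<le> s\<close> unfolding cadlag_absorbed_def by (metis insertI1 order_trans)
  moreover have "t0 \<le> s + real (nat \<lceil>t0 - s\<rceil>)"
    by linarith
  ultimately show "\<exists>n::nat. Z (s + real n) w = 0"
    by blast
next
  assume "\<exists>n::nat. Z (s + real n) w = 0"
  then obtain n :: nat where "Z (s + real n) w = 0"
    by blast
  then have "hit_zero Z s w \<le> ereal (s + real n)"
    unfolding hit_zero_def by (intro Inf_lower) simp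
  then show "hit_zero Z s w < \<infinity>"
    by (rule order_le_less_trans) simp
qed

lemma herglotz_branching_kernels_no_mass_at_zero:
  fixes q d :: "real \<Rightarrow> real" and \<pi> :: "real \<Rightarrow> real measure"
    and v :: "real \<Rightarrow> real \<Rightarrow> complex \<Rightarrow> complex"
    and k :: "real \<Rightarrow> real \<Rightarrow> ennreal \<Rightarrow> ennreal measure"
  assumes q_nonneg: "\<forall>t\<ge>0. q t \<ge> 0"
    and d_loc: "\<forall>T\<ge>0. set_integrable lborel {0..T} d"
    and v_ev: "reverse_evolution_family (herglotz_phi q d \<pi>) v"
    and kernels: "branching_kernels v k"
    and st: "0 \<le> s" "s \<le> t" and x: "0 < x"
  shows "measure (k s t x) {0} = 0"
proof -
  have "(\<lambda>r. \<bar>d r\<bar>) integrable_on {0..t}"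
    using d_loc st by (intro set_borel_integral_eq_integral(1) set_integrable_abs) auto
  then have d_int: "(\<lambda>r. \<bar>d r\<bar>) integrable_on {s..t}"
    by (rule integrable_on_subinterval) (use st in auto)
  have "\<theta> * exp (- integral {s..t} (\<lambda>r. \<bar>d r\<bar>)) \<le> Re (v s t (complex_of_real \<theta>))"
    if "0 < \<theta>" for \<theta>
    using reverse_evolution_family_Re_lower_bound[OF q_nonneg v_ev st _ d_int, of "complex_of_real \<theta>"]
      that
    by (simp add: right_half_plane_def)
  then show ?thesis
    by (intro branching_kernels_no_mass_at_zero[OF kernels st x]) auto
qed

theorem mainTheorem15:
  fixes q d :: "real \<Rightarrow> real"
    and \<pi> :: "real \<Rightarrow> real measure"
    and v :: "real \<Rightarrow> real \<Rightarrow> complex \<Rightarrow> complex"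
    and k :: "real \<Rightarrow> real \<Rightarrow> ennreal \<Rightarrow> ennreal measure"
    and P :: "real \<Rightarrow> ennreal \<Rightarrow> 'w measure"
    and Z :: "real \<Rightarrow> 'w \<Rightarrow> ennreal"
  assumes q_nonneg: "\<forall>t\<ge>0. q t \<ge> 0"
    and q_loc: "\<forall>T\<ge>0. set_integrable lborel {0..T} q"
    and d_loc: "\<forall>T\<ge>0. set_integrable lborel {0..T} d"
    and \<pi>_borel: "\<forall>t\<ge>0. sets (\<pi> t) = sets borel"
    and \<pi>_pos: "\<forall>t\<ge>0. emeasure (\<pi> t) {..0} = 0"
    and \<pi>_loc: "loc_integrable_family (\<lambda>t. density (\<pi> t) (\<lambda>x. ennreal (min x 1)))"
    and v_ev: "reverse_evolution_family (herglotz_phi q d \<pi>) v"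
    and kernels: "branching_kernels v k"
    and process: "branching_process k P Z"
    and s_nonneg: "0 \<le> s"
    and x_pos: "0 < x"
  shows "{w \<in> space (P s x). hit_zero Z s w < \<infinity>} \<in> sets (P s x) \<and>
         measure (P s x) {w \<in> space (P s x). hit_zero Z s w < \<infinity>} = 0"
proof -
  have zero_null: "{w \<in> space (P s x). Z t w = 0} \<in> null_sets (P s x)" if "s \<le> t" for t
    using herglotz_branching_kernels_no_mass_at_zero[OF q_nonneg d_loc v_ev kernels s_nonneg that x_pos]
    by (rule branching_process_zero_null[OF process s_nonneg that])
  have paths: "cadlag_absorbed (\<lambda>t. Z t w)" if "w \<in> space (P s x)" for w
    using process s_nonneg that unfolding branching_process_def by blast
  have "hit_zero Z s w < \<infinity> \<longleftrightarrow> (\<exists>n::nat. Z (s + real n) w = 0)" if "w \<in> space (P s x)" for w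
    by (rule hit_zero_less_infinity_iff[where Z = Z, OF paths[OF that] s_nonneg])
  then have "{w \<in> space (P s x). hit_zero Z s w < \<infinity>}
      = (\<Union>n::nat. {w \<in> space (P s x). Z (s + real n) w = 0})"
    by blast
  also have "\<dots> \<in> null_sets (P s x)"
    using zero_null by (intro null_sets_UN) simp
  finally show ?thesis
    using measure_eq_0_null_sets null_setsD2 by blast
qed

end
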